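(* The Grassroots Dissemination protocol $\mathcal{G}\mathcal{D}$ is grassroots; that is, writing $GD(P)$ for its member over $P$, $\emptyset\subset P\subset P'\subseteq\Pi$ implies $GD(P)\subset GD(P')/P$.
   Context: $\Pi$ is a (possibly infinite) set of agents; sets of agents $P,P'\subseteq\Pi$ referred to below are finite; $\subset$ denotes strict inclusion. **Transition systems and protocols.** A local states function $S$ maps each $P\subseteq\Pi$ to a set $S(P)$ of local states, with $S(\emptyset)=\{s0\}$, $P\subset P'\implies S(P)\subset S(P')$, and a partial order on $S(\Pi)$ with unique least element $s0$. A configuration over $P$ and $X\subseteq S(\Pi)$ is an element $c\in C:=X^P$, with $c_p$ the local state of $p$, and $c0:=\{s0\}^P$ the initial configuration. A transition is a pair $c\rightarrow c'\in C^2$; it is a $p$-transition if $c_p\neq c'_p$ and $c_q=c'_q$ for all $q\ne p$. A distributed multiagent transition system $(P,X,T,\lambda)$ has correct transitions $T=\bigcup_{p\in P}T_p$, $T_p$ a set of $p$-transitions, and a liveness requirement $\lambda\subset 2^T$. A protocol over $S$ is a family with exactly one transition system $TS(P)=(P,S(P),T(P),\lambda(P))$ for every $\emptyset\subset P\subseteq\Pi$. **Projection.** For $\emptyset\subset P\subset P'\subseteq\Pi$ and $c'$ over $P'$ and $S(P')$, $c'/P$ is the configuration over $P$ (local states in $S(P')$) with $(c'/P)_p=c'_p$. For $TS(P')=(P',S(P'),T',\lambda')$, $TS(P')/P:=(P,S(P'),T'/P,\lambda'/P)$ with $T'/P=\{c_1/P\rightarrow c_2/P:c_1\rightarrow c_2\in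 T'\}$ and $\lambda'/P=\{L/P:L\in\lambda'\}$, $L/P$ defined likewise. **Subset, grassroots.** $(P,X,T,\lambda)\subseteq(P,X',T',\lambda')$ if $X\subseteq X'$, $T\subseteq T'$ and $\lambda=\{L\cap T:L\in\lambda'\}$; $\subset$ is the strict version ($\subseteq$ and not equal). A protocol is grassroots if $\emptyset\subset P\subset P'\subseteq\Pi$ implies $TS(P)\subset TS(P')/P$. **Simple blocks.** A payloads function $\mathcal{X}$ maps each set of agents $P$ to a set of payloads $\mathcal{X}(P)$ (with $P\subseteq P'$ implying $\mathcal{X}(P)\subseteq\mathcal{X}(P')$), which includes the payload $(\textit{follow},q)$ for each $q\in P$. A simple block over $P$ is a pair $((p,i),x)$, $p\in P$, $i\in\mathbb{N}$, $x\in\mathcal{X}(P)$; it is an $i$-indexed simple $p$-block with payload $x$. $B(P)$ is the set of all simple blocks over $P$, and $SB(P)$ is the set of all subsets of $B(P)$, ordered by inclusion with initial local state $\emptyset$. **Follows, needs, friends.** In a configuration $c$ over $P$ and $SB$: $p$ follows $q$ if $c_p$ includes a $p$-block with payload $(\textit{follow},q)$; $p$ needs the $q$-block $b$ if $p$ follows $q$ in $c$ and $b\in c_q\setminus c_p$; $p$ and $q$ are friends if they follow each other in $c$. **Grassroots Dissemination.** The protocol $\mathcal{G}\mathcal{D}$ over $SB$ has for each $P$ the transition system $GD(P)=(P,SB(P),T,\lambda)$, where $T_p$ has a $p$-transition $c\rightarrow c'$, for every $p\in P$, with $c'_p=c_p\cup\{b\}$, $b=(\mathrm{Id},x)\notin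 c_p$, and either 1. Create: $\mathrm{Id}=(p,i)$, where $i=\max\{j\geq 0: c_p \text{ contains a } j\text{-indexed } p\text{-block}\}+1$ (the max being $0$ if there is none), $x\in\mathcal{X}(P)$; or 2. $q$-Disseminates-$b$: $b\in c_q$ for some $q\in P$, $p$ and $q$ are friends in $c$, and $p$ needs $b$ in $c$. $\lambda$ includes, for each $p,q\in P$ and $b\in B(P)$, the set of all $p$-transitions labeled $q$-Disseminates-$b$ (and nothing else).
   Formalization: The payloads (follow,q), q in Π, in X(P) are taken to be exactly those with q in P, rather than merely to include them; if X(P) may contain (follow,r) with r in Π outside P, the claim is false in general (e.g. P={p,q}, P'={p,q,r}). *)

theory Defs
  imports Main "HOL-Library.FuncSet"
begin

subsection \<open>Transition systems and protocols\<close>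

text \<open>The parameter \<open>Ag\<close> is the (possibly infinite) set of all agents. A configuration over
  \<open>P\<close> and \<open>X\<close> is an element of \<open>P \<rightarrow>\<^sub>E X\<close>, so that configurations that agree on \<open>P\<close> are equal.\<close>

type_synonym ('a, 's) config = "'a \<Rightarrow> 's"
type_synonym ('a, 's) transition = "('a, 's) config \<times> ('a, 's) config"

definition configs :: "'a set \<Rightarrow> 's set \<Rightarrow> ('a, 's) config set" where
  "configs P X = P \<rightarrow>\<^sub>E X"

definition p_transition :: "'a set \<Rightarrow> 's set \<Rightarrow> 'a \<Rightarrow> ('a, 's) transition \<Rightarrow> bool" where
  "p_transition P X p t \<longleftrightarrow>
     t \<in> configs P X \<times> configs P X \<and>
     fst t p \<noteq> snd t p \<and> (\<forall>q\<in>P. q \<noteq> p \<longrightarrow> fst t q = snd t q)"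

record ('a, 's) transition_system =
  agents :: "'a set"
  states :: "'s set"
  transitions :: "('a, 's) transition set"
  liveness :: "('a, 's) transition set set"

definition local_states_function ::
    "'a set \<Rightarrow> ('a set \<Rightarrow> 's set) \<Rightarrow> 's \<Rightarrow> ('s \<Rightarrow> 's \<Rightarrow> bool) \<Rightarrow> bool" where
  "local_states_function Ag S s0 le \<longleftrightarrow>
     S {} = {s0} \<and>
     (\<forall>P P'. P \<subset> P' \<and> P' \<subseteq> Ag \<longrightarrow> S P \<subset> S P') \<and>
     reflp_on (S Ag) le \<and> transp_on (S Ag) le \<and> antisymp_on (S Ag) le \<and>
     {s \<in> S Ag. \<forall>s'\<in>S Ag. le s s'} = {s0}"

definition distributed_system ::
    "'a set \<Rightarrow> ('a set \<Rightarrow> 's set) \<Rightarrow> ('a, 's) transition_system \<Rightarrow> bool" where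
  "distributed_system Ag S TS \<longleftrightarrow>
     agents TS \<subseteq> Ag \<and> states TS \<subseteq> S Ag \<and>
     (\<exists>T. (\<forall>p\<in>agents TS. \<forall>t\<in>T p. p_transition (agents TS) (states TS) p t) \<and>
          transitions TS = (\<Union>p\<in>agents TS. T p)) \<and>
     liveness TS \<subset> Pow (transitions TS)"

definition protocol ::
    "'a set \<Rightarrow> ('a set \<Rightarrow> 's set) \<Rightarrow> 's \<Rightarrow> ('s \<Rightarrow> 's \<Rightarrow> bool) \<Rightarrow>
     ('a set \<Rightarrow> ('a, 's) transition_system) \<Rightarrow> bool" where
  "protocol Ag S s0 le TS \<longleftrightarrow>
     local_states_function Ag S s0 le \<and>
     (\<forall>P. finite P \<and> {} \<subset> P \<and> P \<subseteq> Ag \<longrightarrow>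
        distributed_system Ag S (TS P) \<and> agents (TS P) = P \<and> states (TS P) = S P)"

definition proj_config :: "('a, 's) config \<Rightarrow> 'a set \<Rightarrow> ('a, 's) config" where
  "proj_config c P = restrict c P"

definition proj_transitions :: "('a, 's) transition set \<Rightarrow> 'a set \<Rightarrow> ('a, 's) transition set" where
  "proj_transitions T P = {(proj_config c1 P, proj_config c2 P) | c1 c2. (c1, c2) \<in> T}"

text \<open>The projection keeps the local states of the larger system.\<close>

definition proj_system ::
    "('a, 's) transition_system \<Rightarrow> 'a set \<Rightarrow> ('a, 's) transition_system" where
  "proj_system TS P =
     \<lparr>agents = P, states = states TS,
      transitions = proj_transitions (transitions TS) P,
      liveness = {proj_transitions L P | L. L \<in> liveness TS}\<rparr>"

definition subsystem ::
    "('a, 's) transition_system \<Rightarrow> ('a, 's) transition_system \<Rightarrow> bool" where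
  "subsystem TS TS' \<longleftrightarrow>
     agents TS = agents TS' \<and> states TS \<subseteq> states TS' \<and>
     transitions TS \<subseteq> transitions TS' \<and>
     liveness TS = {L \<inter> transitions TS | L. L \<in> liveness TS'}"

definition strict_subsystem ::
    "('a, 's) transition_system \<Rightarrow> ('a, 's) transition_system \<Rightarrow> bool" where
  "strict_subsystem TS TS' \<longleftrightarrow> subsystem TS TS' \<and> TS \<noteq> TS'"

definition grassroots ::
    "'a set \<Rightarrow> ('a set \<Rightarrow> 's set) \<Rightarrow> 's \<Rightarrow> ('s \<Rightarrow> 's \<Rightarrow> bool) \<Rightarrow>
     ('a set \<Rightarrow> ('a, 's) transition_system) \<Rightarrow> bool" where
  "grassroots Ag S s0 le TS \<longleftrightarrow>
     protocol Ag S s0 le TS \<and>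
     (\<forall>P P'. finite P' \<and> {} \<subset> P \<and> P \<subset> P' \<and> P' \<subseteq> Ag \<longrightarrow>
        strict_subsystem (TS P) (proj_system (TS P') P))"

subsection \<open>Simple blocks\<close>

datatype ('a, 'x) payload = Follow 'a | Content 'x

type_synonym ('a, 'x) block = "('a \<times> nat) \<times> ('a, 'x) payload"

text \<open>The follow payloads in \<open>X P\<close> are exactly those naming agents of \<open>P\<close>. If \<open>X P\<close> were allowed
  to contain \<open>Follow r\<close> with \<open>r \<notin> P\<close>, then the \<open>GD\<close> protocol defined below would not be
  grassroots in general. Take \<open>P = {p, q}\<close> and \<open>P' = {p, q, r}\<close>, with \<open>Follow r\<close> in \<open>X P\<close>, and
  let \<open>b\<close> be a \<open>q\<close>-block over \<open>P\<close>. In \<open>GD P'\<close>, the transitions in which \<open>r\<close> disseminates \<open>b\<close> to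
  \<open>p\<close> require \<open>p\<close> to follow \<open>r\<close>. Their projections that are transitions of \<open>GD P\<close> form
  a nonempty proper subset of those in which \<open>q\<close> disseminates \<open>b\<close> to \<open>p\<close>, and so are not
  a liveness requirement of \<open>GD P\<close>.\<close>

definition payloads_function :: "'a set \<Rightarrow> ('a set \<Rightarrow> ('a, 'x) payload set) \<Rightarrow> bool" where
  "payloads_function Ag X \<longleftrightarrow>
     (\<forall>P P'. P \<subseteq> P' \<and> P' \<subseteq> Ag \<longrightarrow> X P \<subseteq> X P') \<and>
     (\<forall>P. P \<subseteq> Ag \<longrightarrow> (\<forall>q\<in>Ag. Follow q \<in> X P \<longleftrightarrow> q \<in> P))"

definition blocks :: "('a set \<Rightarrow> ('a, 'x) payload set) \<Rightarrow> 'a set \<Rightarrow> ('a, 'x) block set" where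
  "blocks X P = {((p, i), x) | p i x. p \<in> P \<and> x \<in> X P}"

definition SB :: "('a set \<Rightarrow> ('a, 'x) payload set) \<Rightarrow> 'a set \<Rightarrow> ('a, 'x) block set set" where
  "SB X P = Pow (blocks X P)"

fun author :: "('a, 'x) block \<Rightarrow> 'a" where
  "author ((p, i), x) = p"

type_synonym ('a, 'x) bconfig = "('a, ('a, 'x) block set) config"

definition follows :: "('a, 'x) bconfig \<Rightarrow> 'a \<Rightarrow> 'a \<Rightarrow> bool" where
  "follows c p q \<longleftrightarrow> (\<exists>i. ((p, i), Follow q) \<in> c p)"

text \<open>What an agent needs is a block of its \<^emph>\<open>author\<close>: the block is known to an author that the
  agent follows. The friend that disseminates the block need not be its author.\<close>

definition needs :: "('a, 'x) bconfig \<Rightarrow> 'a \<Rightarrow> ('a, 'x) block \<Rightarrow> bool" where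
  "needs c p b \<longleftrightarrow> follows c p (author b) \<and> b \<in> c (author b) - c p"

definition friends :: "('a, 'x) bconfig \<Rightarrow> 'a \<Rightarrow> 'a \<Rightarrow> bool" where
  "friends c p q \<longleftrightarrow> follows c p q \<and> follows c q p"

subsection \<open>Grassroots Dissemination\<close>

definition indices :: "('a, 'x) block set \<Rightarrow> 'a \<Rightarrow> nat set" where
  "indices s p = {j. \<exists>x. ((p, j), x) \<in> s}"

text \<open>Local states may be infinite. If the indices of the \<open>p\<close>-blocks in a local state of \<open>p\<close> are
  unbounded, then they have no maximum and \<open>p\<close> can create no block.\<close>

definition creates ::
    "('a set \<Rightarrow> ('a, 'x) payload set) \<Rightarrow> 'a set \<Rightarrow> 'a \<Rightarrow>
     ('a, 'x) bconfig \<Rightarrow> ('a, 'x) block \<Rightarrow> bool" where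
  "creates X P p c b \<longleftrightarrow>
     finite (indices (c p) p) \<and>
     (\<exists>x\<in>X P. b = ((p, Max (insert 0 (indices (c p) p)) + 1), x))"

definition disseminates ::
    "'a \<Rightarrow> 'a \<Rightarrow> ('a, 'x) bconfig \<Rightarrow> ('a, 'x) block \<Rightarrow> bool" where
  "disseminates p q c b \<longleftrightarrow> b \<in> c q \<and> friends c p q \<and> needs c p b"

definition adds_block :: "'a \<Rightarrow> ('a, 'x) block \<Rightarrow> ('a, ('a, 'x) block set) transition \<Rightarrow> bool" where
  "adds_block p b t \<longleftrightarrow> b \<notin> fst t p \<and> snd t p = fst t p \<union> {b}"

definition GD_transitions ::
    "('a set \<Rightarrow> ('a, 'x) payload set) \<Rightarrow> 'a set \<Rightarrow> 'a \<Rightarrow>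
     ('a, ('a, 'x) block set) transition set" where
  "GD_transitions X P p =
     {t. p_transition P (SB X P) p t \<and>
         (\<exists>b. adds_block p b t \<and>
              (creates X P p (fst t) b \<or> (\<exists>q\<in>P. disseminates p q (fst t) b)))}"

text \<open>The \<open>p\<close>-transitions labeled \<open>q\<close>-Disseminates-\<open>b\<close>.\<close>

definition GD_disseminations ::
    "('a set \<Rightarrow> ('a, 'x) payload set) \<Rightarrow> 'a set \<Rightarrow> 'a \<Rightarrow> 'a \<Rightarrow> ('a, 'x) block \<Rightarrow>
     ('a, ('a, 'x) block set) transition set" where
  "GD_disseminations X P p q b =
     {t \<in> GD_transitions X P p. adds_block p b t \<and> disseminates p q (fst t) b}"

definition GD ::
    "('a set \<Rightarrow> ('a, 'x) payload set) \<Rightarrow> 'a set \<Rightarrow> ('a, ('a, 'x) block set) transition_system" where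
  "GD X P =
     \<lparr>agents = P, states = SB X P,
      transitions = (\<Union>p\<in>P. GD_transitions X P p),
      liveness = {GD_disseminations X P p q b | p q b. p \<in> P \<and> q \<in> P \<and> b \<in> blocks X P}\<rparr>"

end

theory Submission
  imports Defs
begin

text \<open>A transition of \<open>GD P\<close> is the projection of the transition of \<open>GD P'\<close> in which the agents
  outside \<open>P\<close> have empty local states. Conversely, let a transition in which \<open>q\<close> disseminates \<open>b\<close>
  to \<open>p\<close> in \<open>GD P'\<close> project to a transition of \<open>GD P\<close>. Then \<open>p \<in> P\<close>, as the local state of \<open>p\<close>
  changes; \<open>q \<in> P\<close>, as \<open>p\<close> holds the payload \<open>Follow q\<close>; and \<open>b\<close> is a block over \<open>P\<close>. So the
  projected liveness requirements restrict either to those of \<open>GD P\<close> or to the empty set, and the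
  latter is one of \<open>GD P\<close> as well, because no agent needs a block of its own.\<close>

section \<open>Monotonicity of payloads, blocks and local states\<close>

lemma payloads_function_mono:
  assumes "payloads_function Ag X" "P \<subseteq> P'" "P' \<subseteq> Ag"
  shows "X P \<subseteq> X P'"
  using assms unfolding payloads_function_def by blast

lemma payloads_function_Follow_iff:
  assumes "payloads_function Ag X" "P \<subseteq> Ag" "q \<in> Ag"
  shows "Follow q \<in> X P \<longleftrightarrow> q \<in> P"
  using assms unfolding payloads_function_def by blast

lemma in_blocks_iff: "((p, i), x) \<in> blocks X P \<longleftrightarrow> p \<in> P \<and> x \<in> X P"
  by (auto simp: blocks_def)

lemma author_in_agents: "b \<in> blocks X P \<Longrightarrow> author b \<in> P"
  by (auto simp: blocks_def)

lemma blocks_mono: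
  assumes "payloads_function Ag X" "P \<subseteq> P'" "P' \<subseteq> Ag"
  shows "blocks X P \<subseteq> blocks X P'"
  using payloads_function_mono[OF assms] assms(2) by (auto simp: blocks_def)

lemma SB_mono:
  assumes "payloads_function Ag X" "P \<subseteq> P'" "P' \<subseteq> Ag"
  shows "SB X P \<subseteq> SB X P'"
  using blocks_mono[OF assms] by (auto simp: SB_def)

lemma SB_strict_mono:
  assumes pf: "payloads_function Ag X" and "P \<subset> P'" "P' \<subseteq> Ag"
  shows "SB X P \<subset> SB X P'"
proof -
  \<comment> \<open>Any block of a new agent \<open>q\<close> separates the two sides. The payload
    \<open>Follow q\<close> is chosen because every payloads function must provide it over
    \<open>P'\<close>.\<close>
  obtain q where q: "q \<in> P'" "q \<notin> P" using assms(2) by blast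
  then have "Follow q \<in> X P'"
    using payloads_function_Follow_iff[OF pf assms(3)] assms(3) by blast
  then have "{((q, 0), Follow q)} \<in> SB X P'" "{((q, 0), Follow q)} \<notin> SB X P"
    using q by (auto simp: SB_def in_blocks_iff)
  then show ?thesis using SB_mono[OF pf _ assms(3)] assms(2) by blast
qed

lemma local_states_function_SB:
  assumes "payloads_function Ag X"
  shows "local_states_function Ag (SB X) {} (\<subseteq>)"
  unfolding local_states_function_def
proof (intro conjI allI impI)
  show "SB X {} = {{}}" by (simp add: SB_def blocks_def)
  show "SB X P \<subset> SB X P'" if "P \<subset> P' \<and> P' \<subseteq> Ag" for P P'
    using SB_strict_mono[OF assms, of P P'] that by simp
  show "{s \<in> SB X Ag. \<forall>s'\<in>SB X Ag. s \<subseteq> s'} = {{}}" by (auto simp: SB_def)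
qed (auto intro!: reflp_onI transp_onI antisymp_onI)

section \<open>Transitions and liveness of \<open>GD\<close>; \<open>GD\<close> is a
  protocol\<close>

lemma GD_simps [simp]:
  "agents (GD X P) = P"
  "states (GD X P) = SB X P"
  "transitions (GD X P) = (\<Union>p\<in>P. GD_transitions X P p)"
  "liveness (GD X P) =
     {GD_disseminations X P p q b | p q b. p \<in> P \<and> q \<in> P \<and> b \<in> blocks X P}"
  by (simp_all add: GD_def)

lemma GD_transitions_p_transition:
  "t \<in> GD_transitions X P p \<Longrightarrow> p_transition P (SB X P) p t"
  by (simp add: GD_transitions_def)

lemma configs_subset: "c \<in> configs P X \<Longrightarrow> p \<in> P \<Longrightarrow> c p \<in> X"
  by (auto simp: configs_def)

lemma p_transition_subset_blocks:
  assumes "p_transition P (SB X P) q t" "p \<in> P"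
  shows "fst t p \<subseteq> blocks X P" "snd t p \<subseteq> blocks X P"
  using assms by (auto simp: p_transition_def SB_def configs_def mem_Times_iff dest!: PiE_mem)

lemma GD_disseminations_GD_transitions:
  "t \<in> GD_disseminations X P p q b \<Longrightarrow> t \<in> GD_transitions X P p"
  by (simp add: GD_disseminations_def)

lemma disseminates_cong:
  assumes "c p = c' p" "c q = c' q" "c (author b) = c' (author b)"
  shows "disseminates p q c b \<longleftrightarrow> disseminates p q c' b"
  using assms by (simp add: disseminates_def friends_def follows_def needs_def)

text \<open>The new index depends on the local state of \<open>p\<close> alone; the set of agents
  enters only through the choice of payload.\<close>

lemma creates_mono:
  assumes "creates X P p c b" "c' p = c p" "X P \<subseteq> X P'"
  shows "creates X P' p c' b"
  using assms by (auto simp: creates_def)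

lemma GD_disseminations_own_block: "GD_disseminations X P p q ((p, i), x) = {}"
  by (auto simp: GD_disseminations_def disseminates_def needs_def)

lemma empty_in_liveness_GD:
  assumes "payloads_function Ag X" "P \<noteq> {}" "P \<subseteq> Ag"
  shows "{} \<in> liveness (GD X P)"
proof -
  obtain p where p: "p \<in> P" using assms(2) by blast
  then have "((p, 0), Follow p) \<in> blocks X P"
    using payloads_function_Follow_iff[OF assms(1,3)] assms(3) by (auto simp: in_blocks_iff)
  moreover have "GD_disseminations X P p p ((p, 0), Follow p) = {}"
    by (rule GD_disseminations_own_block)
  ultimately show ?thesis using p unfolding GD_simps by blast
qed

text \<open>The set of all transitions is not a liveness requirement, because an agent with an empty local
  state can create a block but is disseminated none.\<close>

lemma liveness_GD_psubset:
  assumes pf: "payloads_function Ag X" and "P \<noteq> {}" "P \<subseteq> Ag"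
  shows "liveness (GD X P) \<subset> Pow (transitions (GD X P))"
proof -
  obtain p where p: "p \<in> P" using assms(2) by blast
  \<comment> \<open>The index is 1 because the maximum over an empty local state defaults to
    0.\<close>
  let ?b = "((p, 1), Follow p) :: ('a, 'b) block"
  let ?c = "\<lambda>r\<in>P. {} :: ('a, 'b) block set"
  let ?t = "(?c, ?c(p := {?b}))"
  have X: "Follow p \<in> X P"
    using payloads_function_Follow_iff[OF pf assms(3)] p assms(3) by blast
  have "p_transition P (SB X P) p ?t"
    using p X by (auto simp: p_transition_def configs_def SB_def in_blocks_iff PiE_iff
        extensional_def)
  moreover have "adds_block p ?b ?t" using p by (simp add: adds_block_def)
  moreover have "creates X P p (fst ?t) ?b" using p X by (simp add: creates_def indices_def)
  ultimately have t: "?t \<in> transitions (GD X P)"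
    using p unfolding GD_simps GD_transitions_def by blast
  \<comment> \<open>The sender must lie in \<open>P\<close>: there its local state is empty, whereas
    outside \<open>P\<close> it would be \<open>undefined\<close>.\<close>
  have "?t \<notin> GD_disseminations X P p' q b" if "q \<in> P" for p' q b
    using that by (simp add: GD_disseminations_def disseminates_def)
  then have "transitions (GD X P) \<notin> liveness (GD X P)"
    using t unfolding GD_simps by blast
  moreover have "liveness (GD X P) \<subseteq> Pow (transitions (GD X P))"
    by (auto dest: GD_disseminations_GD_transitions)
  ultimately show ?thesis by blast
qed

lemma protocol_GD:
  assumes pf: "payloads_function Ag X"
  shows "protocol Ag (SB X) {} (\<subseteq>) (GD X)"
  unfolding protocol_def
proof (intro conjI allI impI local_states_function_SB[OF pf])
  fix P assume "finite P \<and> {} \<subset> P \<and> P \<subseteq> Ag"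
  then have P: "P \<noteq> {}" "P \<subseteq> Ag" by auto
  have "\<exists>T. (\<forall>p\<in>P. \<forall>t\<in>T p. p_transition P (SB X P) p t) \<and>
          transitions (GD X P) = (\<Union>p\<in>P. T p)"
    by (intro exI[of _ "GD_transitions X P"]) (auto intro: GD_transitions_p_transition)
  then show "distributed_system Ag (SB X) (GD X P)"
    unfolding distributed_system_def GD_simps(1,2)
    using P(2) SB_mono[OF pf P(2)] liveness_GD_psubset[OF pf P] by blast
qed simp_all

section \<open>Extending configurations from \<open>P\<close> to \<open>P'\<close>\<close>

definition extend_config ::
    "'a set \<Rightarrow> 'a set \<Rightarrow> ('a, 'b set) config \<Rightarrow> ('a, 'b set) config" where
  "extend_config P P' c = (\<lambda>p\<in>P'. if p \<in> P then c p else {})"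

lemma extend_config_apply [simp]: "P \<subseteq> P' \<Longrightarrow> p \<in> P \<Longrightarrow> extend_config P P' c p = c p"
  by (auto simp: extend_config_def)

text \<open>The two functions agree outside \<open>P\<close> as well, where both are
  \<open>undefined\<close> since \<open>c\<close> is extensional.\<close>

lemma proj_extend_config:
  assumes "c \<in> configs P Y" "P \<subseteq> P'"
  shows "proj_config (extend_config P P' c) P = c"
proof
  fix p show "proj_config (extend_config P P' c) P p = c p"
    using assms by (cases "p \<in> P") (auto simp: proj_config_def configs_def dest: PiE_arb)
qed

text \<open>The added agents hold \<open>{}\<close>, a local state over every set of agents, both
  before and after, so \<open>p\<close> remains the only agent that changes.\<close>

lemma p_transition_extend_config:
  assumes t: "p_transition P (SB X P) p (c, d)" and "p \<in> P" "P \<subseteq> P'" "SB X P \<subseteq> SB X P'"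
  shows "p_transition P' (SB X P') p (extend_config P P' c, extend_config P P' d)"
proof -
  have "extend_config P P' e \<in> configs P' (SB X P')" if "e \<in> configs P (SB X P)" for e
  proof -
    have "{} \<in> SB X P'" by (simp add: SB_def)
    then show ?thesis
      using configs_subset[OF that] subsetD[OF assms(4)]
      by (simp add: configs_def extend_config_def)
  qed
  then show ?thesis
    using t assms(2,3) by (auto simp: p_transition_def extend_config_def)
qed

lemma disseminates_extend_config:
  assumes "p_transition P (SB X P) p t" "p \<in> P" "q \<in> P" "P \<subseteq> P'" "disseminates p q (fst t) b"
  shows "disseminates p q (extend_config P P' (fst t)) b"
proof -
  have "b \<in> fst t q" using assms(5) by (simp add: disseminates_def)
  then have "author b \<in> P"
    using p_transition_subset_blocks(1)[OF assms(1,3)] author_in_agents by blast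
  then show ?thesis
    using assms disseminates_cong[of "fst t" p "extend_config P P' (fst t)" q b] by simp
qed

lemma GD_transitions_extend_config:
  assumes pf: "payloads_function Ag X" and "P \<subseteq> P'" "P' \<subseteq> Ag" "p \<in> P"
    and t: "(c, d) \<in> GD_transitions X P p"
  shows "(extend_config P P' c, extend_config P P' d) \<in> GD_transitions X P' p"
proof -
  have pt: "p_transition P (SB X P) p (c, d)" using t by (rule GD_transitions_p_transition)
  obtain b where b: "adds_block p b (c, d)"
    and cd: "creates X P p c b \<or> (\<exists>q\<in>P. disseminates p q c b)"
    using t by (auto simp: GD_transitions_def)
  have "creates X P' p (extend_config P P' c) b \<or>
      (\<exists>q\<in>P'. disseminates p q (extend_config P P' c) b)"
    using cd
  proof
    assume "creates X P p c b"
    then show ?thesis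
      using creates_mono payloads_function_mono[OF pf assms(2,3)] assms(2,4)
        extend_config_apply by metis
  next
    assume "\<exists>q\<in>P. disseminates p q c b"
    then show ?thesis
      using disseminates_extend_config[OF pt assms(4) _ assms(2)] assms(2)
      unfolding fst_conv by blast
  qed
  moreover have "adds_block p b (extend_config P P' c, extend_config P P' d)"
    using b assms(2,4) by (simp add: adds_block_def)
  ultimately show ?thesis
    using p_transition_extend_config[OF pt assms(4,2) SB_mono[OF pf assms(2,3)]]
    unfolding GD_transitions_def mem_Collect_eq fst_conv by blast
qed

lemma GD_disseminations_extend_config:
  assumes pf: "payloads_function Ag X" and "P \<subseteq> P'" "P' \<subseteq> Ag" "p \<in> P" "q \<in> P"
    and t: "(c, d) \<in> GD_disseminations X P p q b"
  shows "(extend_config P P' c, extend_config P P' d) \<in> GD_disseminations X P' p q b"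
proof -
  have T: "(c, d) \<in> GD_transitions X P p" and "adds_block p b (c, d)"
    and dis: "disseminates p q (fst (c, d)) b"
    using t by (auto simp: GD_disseminations_def)
  then have "adds_block p b (extend_config P P' c, extend_config P P' d)"
    using assms(2,4) by (simp add: adds_block_def)
  then show ?thesis
    using GD_transitions_extend_config[OF pf assms(2-4) T]
      disseminates_extend_config[OF GD_transitions_p_transition[OF T] assms(4,5,2) dis]
    by (simp add: GD_disseminations_def)
qed

lemma proj_transitions_extend_config:
  assumes "(extend_config P P' c, extend_config P P' d) \<in> T" "p_transition P Y p (c, d)" "P \<subseteq> P'"
  shows "(c, d) \<in> proj_transitions T P"
proof -
  have "c \<in> configs P Y" "d \<in> configs P Y" using assms(2) by (auto simp: p_transition_def)
  then have "proj_config (extend_config P P' c) P = c" "proj_config (extend_config P P' d) P = d"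
    using proj_extend_config assms(3) by blast+
  then show ?thesis using assms(1) unfolding proj_transitions_def by (simp, metis)
qed

lemma transitions_GD_subset_proj:
  assumes pf: "payloads_function Ag X" and "P \<subseteq> P'" "P' \<subseteq> Ag"
  shows "transitions (GD X P) \<subseteq> proj_transitions (transitions (GD X P')) P"
proof
  fix t assume "t \<in> transitions (GD X P)"
  then obtain p c d where p: "p \<in> P" and t: "t = (c, d)" "(c, d) \<in> GD_transitions X P p"
    by (cases t) auto
  have "(extend_config P P' c, extend_config P P' d) \<in> transitions (GD X P')"
    using GD_transitions_extend_config[OF pf assms(2,3) p t(2)] p assms(2) by auto
  then show "t \<in> proj_transitions (transitions (GD X P')) P"
    using proj_transitions_extend_config GD_transitions_p_transition t assms(2) by metis
qed

section \<open>Projecting disseminations from \<open>P'\<close> to \<open>P\<close>\<close>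

lemma proj_GD_disseminations_memE:
  assumes pf: "payloads_function Ag X" and "P \<subseteq> P'" "P' \<subseteq> Ag" "q \<in> P'"
    and proj: "t \<in> proj_transitions (GD_disseminations X P' p q b) P"
    and t: "t \<in> transitions (GD X P)"
  shows "p \<in> P" "q \<in> P" "b \<in> blocks X P" "t \<in> GD_disseminations X P p q b"
proof -
  obtain c d where cd: "t = (proj_config c P, proj_config d P)"
    and dis: "(c, d) \<in> GD_disseminations X P' p q b"
    using proj by (auto simp: proj_transitions_def)
  have pt': "p_transition P' (SB X P') p (c, d)"
    using dis by (intro GD_transitions_p_transition GD_disseminations_GD_transitions)
  obtain r where r: "r \<in> P" and tr: "t \<in> GD_transitions X P r" using t by auto
  have pt: "p_transition P (SB X P) r t" using tr by (rule GD_transitions_p_transition)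
  \<comment> \<open>The projection changes the local state of \<open>r\<close>, while its preimage
    changes only that of \<open>p\<close>.\<close>
  have "c r \<noteq> d r" using pt r by (simp add: p_transition_def cd proj_config_def)
  then have "r = p" using pt' r assms(2) by (auto simp: p_transition_def)
  with r show p: "p \<in> P" by simp
  have add: "adds_block p b t"
    using dis p by (simp add: GD_disseminations_def adds_block_def cd proj_config_def)
  then show b: "b \<in> blocks X P"
    using p_transition_subset_blocks(2)[OF pt p] by (auto simp: adds_block_def)
  have dis': "disseminates p q c b" using dis by (simp add: GD_disseminations_def)
  then obtain i where "((p, i), Follow q) \<in> c p"
    by (auto simp: disseminates_def friends_def follows_def)
  then have "((p, i), Follow q) \<in> blocks X P"
    using p_transition_subset_blocks(1)[OF pt p] p by (auto simp: cd proj_config_def)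
  \<comment> \<open>This uses the converse half of the \<open>Follow\<close> condition: a payload in
    \<open>X P\<close> can name an agent of \<open>Ag\<close> only if that agent is in
    \<open>P\<close>.\<close>
  then show q: "q \<in> P"
    using payloads_function_Follow_iff[OF pf, of P q] assms(2-4) by (auto simp: in_blocks_iff)
  have "disseminates p q (fst t) b"
    using dis' p q author_in_agents[OF b] disseminates_cong[of "fst t" p c q b]
    by (simp add: cd proj_config_def)
  then show "t \<in> GD_disseminations X P p q b"
    using add tr \<open>r = p\<close> by (simp add: GD_disseminations_def)
qed

text \<open>The intersection discards projected transitions whose local states contain blocks over
  \<open>P'\<close> that are not over \<open>P\<close>. What remains is recovered by extending and
  projecting back.\<close>

lemma proj_GD_disseminations_Int:
  assumes pf: "payloads_function Ag X" and "P \<subseteq> P'" "P' \<subseteq> Ag" "p \<in> P" "q \<in> P"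
  shows "proj_transitions (GD_disseminations X P' p q b) P \<inter> transitions (GD X P) =
    GD_disseminations X P p q b"
proof (intro equalityI subsetI)
  fix t assume "t \<in> proj_transitions (GD_disseminations X P' p q b) P \<inter> transitions (GD X P)"
  then show "t \<in> GD_disseminations X P p q b"
    using proj_GD_disseminations_memE(4)[OF pf assms(2,3)] assms(2,5) by blast
next
  fix t assume t: "t \<in> GD_disseminations X P p q b"
  obtain c d where cd: "t = (c, d)" by (cases t)
  have T: "t \<in> GD_transitions X P p" using t by (rule GD_disseminations_GD_transitions)
  have "t \<in> proj_transitions (GD_disseminations X P' p q b) P"
    using GD_disseminations_extend_config[OF pf assms(2-5)] t GD_transitions_p_transition[OF T]
      proj_transitions_extend_config[OF _ _ assms(2)] unfolding cd by blast
  then show "t \<in> proj_transitions (GD_disseminations X P' p q b) P \<inter> transitions (GD X P)"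
    using T assms(4) by auto
qed

lemma liveness_GD_eq_proj:
  assumes pf: "payloads_function Ag X" and "P \<noteq> {}" "P \<subseteq> P'" "P' \<subseteq> Ag"
  shows "liveness (GD X P) =
    {L \<inter> transitions (GD X P) | L. L \<in> liveness (proj_system (GD X P') P)}" (is "_ = ?R")
proof (intro equalityI subsetI)
  fix K assume "K \<in> liveness (GD X P)"
  then obtain p q b where "K = GD_disseminations X P p q b" "p \<in> P" "q \<in> P" "b \<in> blocks X P"
    by auto
  moreover from this have
    "K = proj_transitions (GD_disseminations X P' p q b) P \<inter> transitions (GD X P)"
    using proj_GD_disseminations_Int[OF pf assms(3,4)] by blast
  moreover have "b \<in> blocks X P'" "p \<in> P'" "q \<in> P'"
    using calculation blocks_mono[OF pf assms(3,4)] assms(3) by blast+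
  ultimately show "K \<in> ?R" unfolding proj_system_def GD_simps transition_system.simps by blast
next
  fix K assume "K \<in> ?R"
  then obtain p q b where K:
    "K = proj_transitions (GD_disseminations X P' p q b) P \<inter> transitions (GD X P)"
    and q: "q \<in> P'"
    by (auto simp: proj_system_def)
  show "K \<in> liveness (GD X P)"
  \<comment> \<open>A member of a nonempty \<open>K\<close> forces \<open>p\<close>,
    \<open>q\<close> and \<open>b\<close> to be over \<open>P\<close>, so triples that are not over
    \<open>P\<close> fall under the empty case.\<close>
  proof (cases "K = {}")
    case True
    then show ?thesis using empty_in_liveness_GD[OF pf assms(2)] assms(3,4) by blast
  next
    case False
    then have "p \<in> P" "q \<in> P" "b \<in> blocks X P"
      using proj_GD_disseminations_memE(1-3)[OF pf assms(3,4) q] K by blast+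
    then show ?thesis
      using proj_GD_disseminations_Int[OF pf assms(3,4)] K unfolding GD_simps(4) by blast
  qed
qed

theorem proposition18:
  fixes Ag :: "'a set" and X :: "'a set \<Rightarrow> ('a, 'x) payload set"
  assumes "payloads_function Ag X"
  shows "grassroots Ag (SB X) {} (\<subseteq>) (GD X)"
  unfolding grassroots_def
proof (intro conjI allI impI protocol_GD[OF assms])
  fix P P' assume "finite P' \<and> {} \<subset> P \<and> P \<subset> P' \<and> P' \<subseteq> Ag"
  then have P: "P \<noteq> {}" "P \<subset> P'" "P \<subseteq> P'" "P' \<subseteq> Ag" by auto
  have SB: "SB X P \<subset> SB X P'" using SB_strict_mono[OF assms P(2,4)] .
  have "subsystem (GD X P) (proj_system (GD X P') P)"
    unfolding subsystem_def
  proof (intro conjI liveness_GD_eq_proj[OF assms P(1,3,4)])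
    show "transitions (GD X P) \<subseteq> transitions (proj_system (GD X P') P)"
      using transitions_GD_subset_proj[OF assms P(3,4)] by (simp add: proj_system_def)
  qed (use SB in \<open>auto simp: proj_system_def\<close>)
  \<comment> \<open>Strictness is already visible in the local states, as the projection keeps those
    of \<open>P'\<close>.\<close>
  moreover have "states (GD X P) \<noteq> states (proj_system (GD X P') P)"
    using SB by (simp add: proj_system_def)
  ultimately show "strict_subsystem (GD X P) (proj_system (GD X P') P)"
    unfolding strict_subsystem_def by metis
qed

end
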